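(* Let $\Lambda$ be a finite, connected, singly connected, locally convex higher-rank tree of rank $k\ge 5$ with more than one vertex. If $\Lambda$ is edge-level non-degenerate, then its $1$-skeleton $\operatorname{Sk}_\Lambda$ is non-planar. Consequently, every finite, connected, singly connected, locally convex, edge-level non-degenerate higher-rank tree with more than one vertex and with planar $1$-skeleton has rank at most $4$.
   Context: Let $\mathbb{N}^k$ be the free abelian monoid with generators $\varepsilon_1,\dots,\varepsilon_k$ (with $0\in\mathbb{N}$). A higher-rank graph of rank $k$ ($k$-graph) is a countable category $\Lambda$ together with a functor $d\colon\Lambda\to\mathbb{N}^k$ satisfying the factorisation property: whenever $d(\lambda)=m+n$ there exist unique $\mu,\nu\in\Lambda$ with $d(\mu)=m$, $d(\nu)=n$ and $\lambda=\mu\nu$. Elements of $\Lambda$ are morphisms; $\mathrm{r},\mathrm{s}\colon\Lambda\to\Lambda^0$ are the range and source maps; $\Lambda^m:=d^{-1}(m)$, and $\Lambda^0=d^{-1}(0)$ is identified with the set of objects (vertices). The composite $\mu\nu$ is defined when $\mathrm{s}(\mu)=\mathrm{r}(\nu)$, and then $\mathrm{r}(\mu\nu)=\mathrm{r}(\mu)$, $\mathrm{s}(\mu\nu)=\mathrm{s}(\nu)$. Elements of $\Lambda^{\varepsilon_i}$ are edges of colour $i$. For $u,v\in\Lambda^0$ and $F\subseteq\Lambda$: $uF=\mathrm{r}^{-1}(u)\cap F$, $Fv=\mathrm{s}^{-1}(v)\cap F$, and $u\Lambda v=\mathrm{r}^{-1}(u)\cap\mathrm{s}^{-1}(v)$.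 The $1$-skeleton $\operatorname{Sk}_\Lambda$ is the $k$-coloured directed graph with vertex set $\Lambda^0$ and edge set $\bigcup_{i\le k}\Lambda^{\varepsilon_i}$. It is planar if its underlying undirected graph admits a planar embedding. Finite: $\Lambda^0$ is finite. Connected: the equivalence relation on $\Lambda^0$ generated by $\{(u,v):u\Lambda v\neq\emptyset\}$ is $\Lambda^0\times\Lambda^0$. Singly connected: $|u\Lambda v|\le 1$ for all $u,v\in\Lambda^0$. Locally convex: for all $i\ne j$ and all $e\in\Lambda^{\varepsilon_i}$, $f\in\Lambda^{\varepsilon_j}$ with $\mathrm{r}(e)=\mathrm{r}(f)$, there exist $e'\in \mathrm{s}(f)\Lambda^{\varepsilon_i}$ and $f'\in \mathrm{s}(e)\Lambda^{\varepsilon_j}$ with $ef'=fe'$. Higher-rank tree: a connected $k$-graph with trivial fundamental group, where the fundamental group at a vertex $v$ is the isotropy group at $v$ of the fundamental groupoid of $\Lambda$, i.e. of the groupoid obtained from the category $\Lambda$ by formally inverting all morphisms. Commuting $(i,j)$-square ($i\neq j$): an element $\lambda\in\Lambda^{\varepsilon_i+\varepsilon_j}$ presented through its two factorisations $\lambda=\mu\nu=\nu'\mu'$ with $d(\mu)=d(\mu')=\varepsilon_i$ and $d(\nu)=d(\nu')=\varepsilon_j$. An edge $e$ lies in the square if $e\in\{\mu,\nu,\nu',\mu'\}$. $\Lambda$ is edge-level non-degenerate if for every colour $i\in\{1,\dots,k\}$, every $e\in\Lambda^{\varepsilon_i}$, and every $j\neq i$, the edge $e$ lies in some commuting $(i,j)$-square.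 *)

theory Defs
  imports
    "HOL-Analysis.Analysis"
    "HOL-Algebra.Elementary_Groups"
    "HOL-Library.Poly_Mapping"
    "Graph_Theory.Digraph"
begin

section \<open>Small categories in single-sorted form\<close>

text \<open>
  Objects are identified with their identity morphisms, so range and source are maps from
  morphisms to morphisms.  The composite \<open>\<mu> \<star>\<^bsub>C\<^esub> \<nu>\<close> is meaningful only if
  \<open>src C \<mu> = rng C \<nu>\<close>.
\<close>

record 'a cat =
  Mor :: "'a set"
  rng :: "'a \<Rightarrow> 'a"
  src :: "'a \<Rightarrow> 'a"
  cmp :: "'a \<Rightarrow> 'a \<Rightarrow> 'a"  (infixl \<open>\<star>\<index>\<close> 70)

locale small_category =
  fixes C :: "('a, 'z) cat_scheme" (structure)
  assumes rng_in: "\<kappa> \<in> Mor C \<Longrightarrow> rng C \<kappa> \<in> Mor C"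
    and src_in: "\<kappa> \<in> Mor C \<Longrightarrow> src C \<kappa> \<in> Mor C"
    and rng_rng: "\<kappa> \<in> Mor C \<Longrightarrow> rng C (rng C \<kappa>) = rng C \<kappa>"
    and src_rng: "\<kappa> \<in> Mor C \<Longrightarrow> src C (rng C \<kappa>) = rng C \<kappa>"
    and rng_src: "\<kappa> \<in> Mor C \<Longrightarrow> rng C (src C \<kappa>) = src C \<kappa>"
    and src_src: "\<kappa> \<in> Mor C \<Longrightarrow> src C (src C \<kappa>) = src C \<kappa>"
    and cmp_in: "\<lbrakk>\<mu> \<in> Mor C; \<nu> \<in> Mor C; src C \<mu> = rng C \<nu>\<rbrakk> \<Longrightarrow> \<mu> \<star> \<nu> \<in> Mor C"
    and rng_cmp: "\<lbrakk>\<mu> \<in> Mor C; \<nu> \<in> Mor C; src C \<mu> = rng C \<nu>\<rbrakk> \<Longrightarrow> rng C (\<mu> \<star> \<nu>) = rng C \<mu>"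
    and src_cmp: "\<lbrakk>\<mu> \<in> Mor C; \<nu> \<in> Mor C; src C \<mu> = rng C \<nu>\<rbrakk> \<Longrightarrow> src C (\<mu> \<star> \<nu>) = src C \<nu>"
    and cmp_assoc: "\<lbrakk>\<kappa> \<in> Mor C; \<mu> \<in> Mor C; \<nu> \<in> Mor C; src C \<kappa> = rng C \<mu>; src C \<mu> = rng C \<nu>\<rbrakk>
      \<Longrightarrow> (\<kappa> \<star> \<mu>) \<star> \<nu> = \<kappa> \<star> (\<mu> \<star> \<nu>)"
    and rng_cmp_id: "\<kappa> \<in> Mor C \<Longrightarrow> rng C \<kappa> \<star> \<kappa> = \<kappa>"
    and cmp_src_id: "\<kappa> \<in> Mor C \<Longrightarrow> \<kappa> \<star> src C \<kappa> = \<kappa>"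

definition objects :: "('a, 'z) cat_scheme \<Rightarrow> 'a set" where
  "objects C = {v \<in> Mor C. rng C v = v \<and> src C v = v}"

definition hom_set :: "('a, 'z) cat_scheme \<Rightarrow> 'a \<Rightarrow> 'a \<Rightarrow> 'a set" where
  "hom_set C u v = {\<kappa> \<in> Mor C. rng C \<kappa> = u \<and> src C \<kappa> = v}"

definition isotropy_group :: "('a, 'z) cat_scheme \<Rightarrow> 'a \<Rightarrow> 'a monoid" where
  "isotropy_group C v = \<lparr>carrier = hom_set C v v, monoid.mult = cmp C, one = v\<rparr>"

section \<open>The fundamental groupoid\<close>

text \<open>
  A zigzag is a word of morphisms and formal inverses: \<open>(\<kappa>, True)\<close> stands for \<open>\<kappa>\<close> and
  \<open>(\<kappa>, False)\<close> for its formal inverse.  Words are read like composites, so a zigzag from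
  \<open>u\<close> to \<open>v\<close> has range \<open>u\<close> and source \<open>v\<close>.
\<close>

type_synonym 'a zigzag = "('a \<times> bool) list"

fun is_zigzag :: "('a, 'z) cat_scheme \<Rightarrow> 'a \<Rightarrow> 'a zigzag \<Rightarrow> 'a \<Rightarrow> bool" where
  "is_zigzag C u [] v \<longleftrightarrow> u \<in> objects C \<and> u = v"
| "is_zigzag C u ((\<kappa>, b) # w) v \<longleftrightarrow> \<kappa> \<in> Mor C \<and>
     (if b then rng C \<kappa> = u \<and> is_zigzag C (src C \<kappa>) w v
      else src C \<kappa> = u \<and> is_zigzag C (rng C \<kappa>) w v)"

definition zigzags :: "('a, 'z) cat_scheme \<Rightarrow> 'a \<Rightarrow> 'a \<Rightarrow> 'a zigzag set" where
  "zigzags C u v = {w. is_zigzag C u w v}"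

inductive zigzag_step :: "('a, 'z) cat_scheme \<Rightarrow> 'a zigzag \<Rightarrow> 'a zigzag \<Rightarrow> bool" for C where
  compose: "\<lbrakk>\<mu> \<in> Mor C; \<nu> \<in> Mor C; src C \<mu> = rng C \<nu>\<rbrakk>
    \<Longrightarrow> zigzag_step C (x @ [(\<mu>, True), (\<nu>, True)] @ y) (x @ [(\<mu> \<star>\<^bsub>C\<^esub> \<nu>, True)] @ y)"
| identity: "v \<in> objects C \<Longrightarrow> zigzag_step C (x @ [(v, True)] @ y) (x @ y)"
| right_inverse: "\<kappa> \<in> Mor C \<Longrightarrow> zigzag_step C (x @ [(\<kappa>, True), (\<kappa>, False)] @ y) (x @ y)"
| left_inverse: "\<kappa> \<in> Mor C \<Longrightarrow> zigzag_step C (x @ [(\<kappa>, False), (\<kappa>, True)] @ y) (x @ y)"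

text \<open>
  All intermediate words are required to be zigzags from \<open>u\<close> to \<open>v\<close>: reversing a deletion step
  could otherwise insert a letter at the wrong object.
\<close>

definition zigzag_eq :: "('a, 'z) cat_scheme \<Rightarrow> 'a \<Rightarrow> 'a \<Rightarrow> ('a zigzag \<times> 'a zigzag) set" where
  "zigzag_eq C u v = {(w, w'). w \<in> zigzags C u v \<and> w' \<in> zigzags C u v \<and>
     equivclp (\<lambda>x y. x \<in> zigzags C u v \<and> y \<in> zigzags C u v \<and> zigzag_step C x y) w w'}"

definition zigzag_class :: "('a, 'z) cat_scheme \<Rightarrow> 'a \<Rightarrow> 'a \<Rightarrow> 'a zigzag \<Rightarrow> 'a zigzag set" where
  "zigzag_class C u v w = zigzag_eq C u v `` {w}"

definition groupoid_unit :: "('a, 'z) cat_scheme \<Rightarrow> 'a \<Rightarrow> 'a \<times> 'a zigzag set \<times> 'a" where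
  "groupoid_unit C u = (u, zigzag_class C u u [], u)"

definition fundamental_groupoid ::
  "('a, 'z) cat_scheme \<Rightarrow> ('a \<times> 'a zigzag set \<times> 'a) cat" where
  "fundamental_groupoid C =
    \<lparr>Mor = {(u, A, v). u \<in> objects C \<and> v \<in> objects C \<and> A \<in> zigzags C u v // zigzag_eq C u v},
     rng = (\<lambda>(u, A, v). groupoid_unit C u),
     src = (\<lambda>(u, A, v). groupoid_unit C v),
     cmp = (\<lambda>(u, A, v) (v', B, w). (u, \<Union>a\<in>A. \<Union>b\<in>B. zigzag_class C u w (a @ b), w))\<rparr>"

definition fundamental_group ::
  "('a, 'z) cat_scheme \<Rightarrow> 'a \<Rightarrow> ('a \<times> 'a zigzag set \<times> 'a) monoid" where
  "fundamental_group C v = isotropy_group (fundamental_groupoid C) (groupoid_unit C v)"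

lemma equiv_zigzag_eq: "equiv (zigzags C u v) (zigzag_eq C u v)"
  by (auto simp: zigzag_eq_def equiv_def refl_on_def sym_def trans_def
      intro: equivclp_sym equivclp_trans)

lemma zigzag_append:
  "is_zigzag C u a v \<Longrightarrow> is_zigzag C v b w \<Longrightarrow> is_zigzag C u (a @ b) w"
  by (induction C u a v rule: is_zigzag.induct) (auto split: if_splits)

lemma zigzag_step_context: "zigzag_step C x y \<Longrightarrow> zigzag_step C (p @ x @ q) (p @ y @ q)"
proof (induction rule: zigzag_step.induct)
  case (compose \<mu> \<nu> x y)
  from zigzag_step.compose[OF this, of "p @ x" "y @ q"] show ?case by simp
next
  case (identity v x y)
  from zigzag_step.identity[OF this, of "p @ x" "y @ q"] show ?case by simp
next
  case (right_inverse \<kappa> x y)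
  from zigzag_step.right_inverse[OF this, of "p @ x" "y @ q"] show ?case by simp
next
  case (left_inverse \<kappa> x y)
  from zigzag_step.left_inverse[OF this, of "p @ x" "y @ q"] show ?case by simp
qed

lemma zigzag_eq_context:
  assumes "(x, y) \<in> zigzag_eq C v w" and p: "is_zigzag C u p v" and q: "is_zigzag C w q z"
  shows "(p @ x @ q, p @ y @ q) \<in> zigzag_eq C u z"
proof -
  let ?R = "\<lambda>u v x y. x \<in> zigzags C u v \<and> y \<in> zigzags C u v \<and> zigzag_step C x y"
  have ctx: "p @ x @ q \<in> zigzags C u z" if "x \<in> zigzags C v w" for x
    using that p q by (auto simp: zigzags_def intro: zigzag_append)
  have "equivclp (?R v w) x y" using assms(1) by (simp add: zigzag_eq_def)
  then have "equivclp (?R u z) (p @ x @ q) (p @ y @ q)"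
  proof (induction rule: equivclp_induct)
    case base then show ?case by simp
  next
    case (step y z')
    then have "?R u z (p @ y @ q) (p @ z' @ q) \<or> ?R u z (p @ z' @ q) (p @ y @ q)"
      using ctx zigzag_step_context by metis
    then have "equivclp (?R u z) (p @ y @ q) (p @ z' @ q)"
      using r_into_equivclp[of "?R u z" "p @ y @ q" "p @ z' @ q"]
        equivclp_sym[OF r_into_equivclp[of "?R u z" "p @ z' @ q" "p @ y @ q"]] by blast
    with step.IH show ?case by (rule equivclp_trans)
  qed
  then show ?thesis using assms(1) ctx by (auto simp: zigzag_eq_def)
qed

lemma zigzag_eq_step:
  "zigzag_step C x y \<Longrightarrow> is_zigzag C u x v \<Longrightarrow> is_zigzag C u y v \<Longrightarrow> (x, y) \<in> zigzag_eq C u v"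
  by (auto simp: zigzag_eq_def zigzags_def intro: r_into_equivclp)

context small_category
begin

lemma rng_object: "\<kappa> \<in> Mor C \<Longrightarrow> rng C \<kappa> \<in> objects C"
  and src_object: "\<kappa> \<in> Mor C \<Longrightarrow> src C \<kappa> \<in> objects C"
  by (auto simp: objects_def rng_in src_in rng_rng src_rng rng_src src_src)

lemma zigzag_ends: "is_zigzag C u w v \<Longrightarrow> u \<in> objects C \<and> v \<in> objects C"
proof (induction w arbitrary: u)
  case (Cons l w) then show ?case by (cases l) (auto split: if_splits simp: rng_object src_object)
qed auto

lemma zigzag_eq_append:
  assumes "(a, a') \<in> zigzag_eq C u v" and "(b, b') \<in> zigzag_eq C v w"
  shows "(a @ b, a' @ b') \<in> zigzag_eq C u w"
proof -
  have z: "is_zigzag C u a' v" "is_zigzag C v b w"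
    using assms by (auto simp: zigzag_eq_def zigzags_def)
  have "(a @ b, a' @ b) \<in> zigzag_eq C u w"
    using zigzag_eq_context[OF assms(1), of u "[]" b w] z zigzag_ends by auto
  moreover have "(a' @ b, a' @ b') \<in> zigzag_eq C u w"
    using zigzag_eq_context[OF assms(2) z(1), of "[]" w] z zigzag_ends by auto
  ultimately show ?thesis using equiv_zigzag_eq[of C u w] by (meson equivE transD)
qed

definition inverse_zigzag :: "'a zigzag \<Rightarrow> 'a zigzag" where
  "inverse_zigzag w = rev (map (\<lambda>(x, b). (x, \<not> b)) w)"

lemma is_zigzag_inverse: "is_zigzag C u w v \<Longrightarrow> is_zigzag C v (inverse_zigzag w) u"
proof (induction w arbitrary: u)
  case Nil then show ?case by (auto simp: inverse_zigzag_def)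
next
  case (Cons l w)
  obtain x b where l: "l = (x, b)" by force
  let ?u' = "if b then src C x else rng C x"
  have x: "x \<in> Mor C" and w: "is_zigzag C ?u' w v" using Cons.prems l by (auto split: if_splits)
  have "is_zigzag C ?u' [(x, \<not> b)] u" using Cons.prems l zigzag_ends[OF Cons.prems] by (auto split: if_splits)
  with Cons.IH[OF w] show ?case
    unfolding l inverse_zigzag_def by (auto intro: zigzag_append)
qed

lemma zigzag_eq_inverse:
  "is_zigzag C u w v \<Longrightarrow> (inverse_zigzag w @ w, []) \<in> zigzag_eq C v v"
proof (induction w arbitrary: u)
  case Nil
  then show ?case by (auto simp: inverse_zigzag_def zigzag_eq_def zigzags_def)
next
  case (Cons l w)
  obtain x b where l: "l = (x, b)" by force
  let ?u' = "if b then src C x else rng C x"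
  have x: "x \<in> Mor C" and w: "is_zigzag C ?u' w v" using Cons.prems l by (auto split: if_splits)
  have "zigzag_step C [(x, \<not> b), (x, b)] []"
    using zigzag_step.left_inverse[OF x, of "[]" "[]"] zigzag_step.right_inverse[OF x, of "[]" "[]"]
    by (cases b) simp_all
  moreover have "is_zigzag C ?u' [(x, \<not> b), (x, b)] ?u'" "is_zigzag C ?u' [] ?u'"
    using x zigzag_ends[OF w] by auto
  ultimately have "([(x, \<not> b), (x, b)], []) \<in> zigzag_eq C ?u' ?u'"
    by (intro zigzag_eq_step) auto
  from zigzag_eq_context[OF this is_zigzag_inverse[OF w] w]
  have "(inverse_zigzag (l # w) @ l # w, inverse_zigzag w @ w) \<in> zigzag_eq C v v"
    by (simp add: l inverse_zigzag_def)
  with Cons.IH[OF w] show ?case using equiv_zigzag_eq[of C v v] by (meson equivE transD)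
qed

lemma fundamental_groupoid_cmp:
  assumes "a \<in> zigzags C u v" "b \<in> zigzags C v w"
  shows "cmp (fundamental_groupoid C) (u, zigzag_class C u v a, v) (v, zigzag_class C v w b, w)
    = (u, zigzag_class C u w (a @ b), w)"
proof -
  have "zigzag_class C u w (a' @ b') = zigzag_class C u w (a @ b)"
    if "a' \<in> zigzag_class C u v a" "b' \<in> zigzag_class C v w b" for a' b'
    using that equiv_class_eq[OF equiv_zigzag_eq zigzag_eq_append]
    by (auto simp: zigzag_class_def)
  moreover have "a \<in> zigzag_class C u v a" "b \<in> zigzag_class C v w b"
    using assms equiv_class_self[OF equiv_zigzag_eq] by (auto simp: zigzag_class_def)
  ultimately have "(\<Union>a'\<in>zigzag_class C u v a. \<Union>b'\<in>zigzag_class C v w b. zigzag_class C u w (a' @ b'))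
      = zigzag_class C u w (a @ b)" by blast
  then show ?thesis by (simp add: fundamental_groupoid_def)
qed

lemma carrier_fundamental_group:
  assumes "v \<in> objects C"
  shows "carrier (fundamental_group C v) = {(v, zigzag_class C v v w, v) | w. w \<in> zigzags C v v}"
  using assms
  by (auto simp: fundamental_group_def isotropy_group_def hom_set_def fundamental_groupoid_def
      groupoid_unit_def zigzag_class_def quotient_def)

theorem group_fundamental_group:
  assumes v: "v \<in> objects C"
  shows "group (fundamental_group C v)"
proof -
  let ?G = "fundamental_group C v"
  let ?c = "\<lambda>w. (v, zigzag_class C v v w, v)"
  have app: "a @ b \<in> zigzags C v v" if "a \<in> zigzags C v v" "b \<in> zigzags C v v" for a b
    using that by (auto simp: zigzags_def intro: zigzag_append)
  have nil: "[] \<in> zigzags C v v" using v by (simp add: zigzags_def)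
  have mult: "?c a \<otimes>\<^bsub>?G\<^esub> ?c b = ?c (a @ b)" if "a \<in> zigzags C v v" "b \<in> zigzags C v v" for a b
    using fundamental_groupoid_cmp[OF that]
    by (simp add: fundamental_group_def isotropy_group_def)
  have one: "\<one>\<^bsub>?G\<^esub> = ?c []"
    by (simp add: fundamental_group_def isotropy_group_def groupoid_unit_def)
  have inv: "inverse_zigzag a \<in> zigzags C v v" "?c (inverse_zigzag a @ a) = ?c []"
    if "a \<in> zigzags C v v" for a
    using that is_zigzag_inverse zigzag_eq_inverse equiv_class_eq[OF equiv_zigzag_eq]
    by (fastforce simp: zigzags_def zigzag_class_def)+
  have carrier: "x \<in> carrier ?G \<longleftrightarrow> (\<exists>a\<in>zigzags C v v. x = ?c a)" for x
    unfolding carrier_fundamental_group[OF v] by auto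
  show ?thesis
  proof (rule groupI)
    fix x y assume "x \<in> carrier ?G" "y \<in> carrier ?G"
    then obtain a b where "a \<in> zigzags C v v" "b \<in> zigzags C v v" "x = ?c a" "y = ?c b"
      by (auto simp: carrier)
    then show "x \<otimes>\<^bsub>?G\<^esub> y \<in> carrier ?G" using mult app carrier by metis
  next
    show "\<one>\<^bsub>?G\<^esub> \<in> carrier ?G" using nil carrier one by metis
  next
    fix x y z assume "x \<in> carrier ?G" "y \<in> carrier ?G" "z \<in> carrier ?G"
    then obtain a b c where *: "a \<in> zigzags C v v" "b \<in> zigzags C v v" "c \<in> zigzags C v v"
      and "x = ?c a" "y = ?c b" "z = ?c c" by (auto simp: carrier)
    then show "x \<otimes>\<^bsub>?G\<^esub> y \<otimes>\<^bsub>?G\<^esub> z = x \<otimes>\<^bsub>?G\<^esub> (y \<otimes>\<^bsub>?G\<^esub> z)"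
      by (simp only: mult[OF *(1,2)] mult[OF *(2,3)] mult[OF app[OF *(1,2)] *(3)]
          mult[OF *(1) app[OF *(2,3)]] append_assoc)
  next
    fix x assume "x \<in> carrier ?G"
    then obtain a where a: "a \<in> zigzags C v v" "x = ?c a" by (auto simp: carrier)
    then show "\<one>\<^bsub>?G\<^esub> \<otimes>\<^bsub>?G\<^esub> x = x" using mult[OF nil a(1)] one by simp
    show "\<exists>y\<in>carrier ?G. y \<otimes>\<^bsub>?G\<^esub> x = \<one>\<^bsub>?G\<^esub>"
      using a inv[OF a(1)] mult[OF inv(1)[OF a(1)] a(1)] one carrier by metis
  qed
qed

end

section \<open>Higher-rank graphs\<close>

text \<open>
  The free abelian monoid on the generators \<open>eps 1, \<dots>, eps k\<close>, realised inside the free abelian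
  monoid on all natural numbers.
\<close>

definition Nk :: "nat \<Rightarrow> (nat \<Rightarrow>\<^sub>0 nat) set" where
  "Nk k = {m. Poly_Mapping.keys m \<subseteq> {1..k}}"

definition eps :: "nat \<Rightarrow> nat \<Rightarrow>\<^sub>0 nat" where
  "eps i = Poly_Mapping.single i 1"

record 'a kgraph = "'a cat" +
  deg :: "'a \<Rightarrow> (nat \<Rightarrow>\<^sub>0 nat)"

locale k_graph = small_category \<Lambda> for k :: nat and \<Lambda> :: "('a, 'z) kgraph_scheme" (structure) +
  assumes countable_Mor: "countable (Mor \<Lambda>)"
    and deg_in: "\<kappa> \<in> Mor \<Lambda> \<Longrightarrow> deg \<Lambda> \<kappa> \<in> Nk k"
    and deg_object: "v \<in> objects \<Lambda> \<Longrightarrow> deg \<Lambda> v = 0"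
    and deg_cmp: "\<lbrakk>\<mu> \<in> Mor \<Lambda>; \<nu> \<in> Mor \<Lambda>; src \<Lambda> \<mu> = rng \<Lambda> \<nu>\<rbrakk>
      \<Longrightarrow> deg \<Lambda> (\<mu> \<star> \<nu>) = deg \<Lambda> \<mu> + deg \<Lambda> \<nu>"
    and factorisation: "\<lbrakk>\<kappa> \<in> Mor \<Lambda>; m \<in> Nk k; n \<in> Nk k; deg \<Lambda> \<kappa> = m + n\<rbrakk>
      \<Longrightarrow> \<exists>!(\<mu>, \<nu>). \<mu> \<in> Mor \<Lambda> \<and> \<nu> \<in> Mor \<Lambda> \<and> src \<Lambda> \<mu> = rng \<Lambda> \<nu> \<and>
             deg \<Lambda> \<mu> = m \<and> deg \<Lambda> \<nu> = n \<and> \<kappa> = \<mu> \<star> \<nu>"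

definition of_degree :: "('a, 'z) kgraph_scheme \<Rightarrow> (nat \<Rightarrow>\<^sub>0 nat) \<Rightarrow> 'a set" where
  "of_degree \<Lambda> m = {\<kappa> \<in> Mor \<Lambda>. deg \<Lambda> \<kappa> = m}"

abbreviation vertices :: "('a, 'z) kgraph_scheme \<Rightarrow> 'a set" where
  "vertices \<Lambda> \<equiv> of_degree \<Lambda> 0"

abbreviation edges :: "('a, 'z) kgraph_scheme \<Rightarrow> nat \<Rightarrow> 'a set" where
  "edges \<Lambda> i \<equiv> of_degree \<Lambda> (eps i)"

lemma (in k_graph) vertices_eq_objects: "vertices \<Lambda> = objects \<Lambda>"
proof
  show "objects \<Lambda> \<subseteq> vertices \<Lambda>"
    using deg_object by (auto simp: of_degree_def objects_def)
  show "vertices \<Lambda> \<subseteq> objects \<Lambda>"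
  proof
    fix v assume "v \<in> vertices \<Lambda>"
    then have v: "v \<in> Mor \<Lambda>" "deg \<Lambda> v = 0" by (auto simp: of_degree_def)
    have r: "rng \<Lambda> v \<in> objects \<Lambda>" and s: "src \<Lambda> v \<in> objects \<Lambda>"
      using v by (auto simp: objects_def rng_in src_in rng_rng src_rng rng_src src_src)
    have "\<exists>!(\<mu>, \<nu>). \<mu> \<in> Mor \<Lambda> \<and> \<nu> \<in> Mor \<Lambda> \<and> src \<Lambda> \<mu> = rng \<Lambda> \<nu> \<and>
             deg \<Lambda> \<mu> = 0 \<and> deg \<Lambda> \<nu> = 0 \<and> v = \<mu> \<star> \<nu>"
      using factorisation[of v 0 0] v by (simp add: Nk_def)
    moreover have "rng \<Lambda> v \<in> Mor \<Lambda>" "src \<Lambda> (rng \<Lambda> v) = rng \<Lambda> v" "deg \<Lambda> (rng \<Lambda> v) = 0"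
      "v = rng \<Lambda> v \<star> v" using v r deg_object by (auto simp: objects_def rng_cmp_id)
    moreover have "src \<Lambda> v \<in> Mor \<Lambda>" "rng \<Lambda> (src \<Lambda> v) = src \<Lambda> v" "deg \<Lambda> (src \<Lambda> v) = 0"
      "v = v \<star> src \<Lambda> v" using v s deg_object by (auto simp: objects_def cmp_src_id)
    ultimately have "(rng \<Lambda> v, v) = (v, src \<Lambda> v)"
      using v by (elim ex1E) (smt (verit) case_prod_conv)
    then show "v \<in> objects \<Lambda>" using v by (simp add: objects_def)
  qed
qed

definition finite_kgraph :: "('a, 'z) kgraph_scheme \<Rightarrow> bool" where
  "finite_kgraph \<Lambda> \<longleftrightarrow> finite (vertices \<Lambda>)"

definition connected_kgraph :: "('a, 'z) kgraph_scheme \<Rightarrow> bool" where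
  "connected_kgraph \<Lambda> \<longleftrightarrow> (\<forall>u\<in>vertices \<Lambda>. \<forall>v\<in>vertices \<Lambda>.
     equivclp (\<lambda>x y. x \<in> vertices \<Lambda> \<and> y \<in> vertices \<Lambda> \<and> hom_set \<Lambda> x y \<noteq> {}) u v)"

text \<open>
  The cardinality bound is spelled out because \<open>card\<close> is \<open>0\<close> on infinite sets.
\<close>

definition singly_connected :: "('a, 'z) kgraph_scheme \<Rightarrow> bool" where
  "singly_connected \<Lambda> \<longleftrightarrow> (\<forall>u\<in>vertices \<Lambda>. \<forall>v\<in>vertices \<Lambda>.
     finite (hom_set \<Lambda> u v) \<and> card (hom_set \<Lambda> u v) \<le> 1)"

definition locally_convex :: "nat \<Rightarrow> ('a, 'z) kgraph_scheme \<Rightarrow> bool" where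
  "locally_convex k \<Lambda> \<longleftrightarrow> (\<forall>i\<in>{1..k}. \<forall>j\<in>{1..k}. i \<noteq> j \<longrightarrow>
     (\<forall>e\<in>edges \<Lambda> i. \<forall>f\<in>edges \<Lambda> j. rng \<Lambda> e = rng \<Lambda> f \<longrightarrow>
       (\<exists>e'\<in>edges \<Lambda> i. \<exists>f'\<in>edges \<Lambda> j. rng \<Lambda> e' = src \<Lambda> f \<and> rng \<Lambda> f' = src \<Lambda> e \<and>
          e \<star>\<^bsub>\<Lambda>\<^esub> f' = f \<star>\<^bsub>\<Lambda>\<^esub> e')))"

definition higher_rank_tree :: "nat \<Rightarrow> ('a, 'z) kgraph_scheme \<Rightarrow> bool" where
  "higher_rank_tree k \<Lambda> \<longleftrightarrow> k_graph k \<Lambda> \<and> connected_kgraph \<Lambda> \<and>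
     (\<forall>v\<in>vertices \<Lambda>. trivial_group (fundamental_group \<Lambda> v))"

definition commuting_square ::
  "('a, 'z) kgraph_scheme \<Rightarrow> nat \<Rightarrow> nat \<Rightarrow> 'a \<Rightarrow> 'a \<Rightarrow> 'a \<Rightarrow> 'a \<Rightarrow> 'a \<Rightarrow> bool" where
  "commuting_square \<Lambda> i j \<kappa> \<mu> \<nu> \<nu>' \<mu>' \<longleftrightarrow>
     \<kappa> \<in> of_degree \<Lambda> (eps i + eps j) \<and>
     \<mu> \<in> edges \<Lambda> i \<and> \<nu> \<in> edges \<Lambda> j \<and> src \<Lambda> \<mu> = rng \<Lambda> \<nu> \<and> \<kappa> = \<mu> \<star>\<^bsub>\<Lambda>\<^esub> \<nu> \<and>
     \<nu>' \<in> edges \<Lambda> j \<and> \<mu>' \<in> edges \<Lambda> i \<and> src \<Lambda> \<nu>' = rng \<Lambda> \<mu>' \<and> \<kappa> = \<nu>' \<star>\<^bsub>\<Lambda>\<^esub> \<mu>'"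

definition edge_nondegenerate :: "nat \<Rightarrow> ('a, 'z) kgraph_scheme \<Rightarrow> bool" where
  "edge_nondegenerate k \<Lambda> \<longleftrightarrow> (\<forall>i\<in>{1..k}. \<forall>e\<in>edges \<Lambda> i. \<forall>j\<in>{1..k}. j \<noteq> i \<longrightarrow>
     (\<exists>\<kappa> \<mu> \<nu> \<nu>' \<mu>'. commuting_square \<Lambda> i j \<kappa> \<mu> \<nu> \<nu>' \<mu>' \<and> e \<in> {\<mu>, \<nu>, \<nu>', \<mu>'}))"

section \<open>The 1-skeleton and planarity\<close>

record ('v, 'e) coloured_digraph = "('v, 'e) pre_digraph" +
  colour :: "'e \<Rightarrow> nat"

definition skeleton :: "nat \<Rightarrow> ('a, 'z) kgraph_scheme \<Rightarrow> ('a, 'a) coloured_digraph" where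
  "skeleton k \<Lambda> = \<lparr>verts = vertices \<Lambda>, arcs = (\<Union>i\<in>{1..k}. edges \<Lambda> i),
     tail = src \<Lambda>, head = rng \<Lambda>, colour = (\<lambda>e. THE i. deg \<Lambda> e = eps i)\<rparr>"

text \<open>
  A planar embedding of the underlying undirected (multi)graph, the plane being \<open>complex\<close>:
  vertices go to distinct points and edges to simple curves joining the images of their ends,
  with the open curves disjoint from the vertices and from each other.  A loop is
  drawn as a simple closed curve, which \<open>simple_path\<close> permits.  The direction of an edge only
  fixes the parametrisation of its curve, so it has no influence on planarity.
\<close>

definition planar_embedding ::
  "('v, 'e, 'z) pre_digraph_scheme \<Rightarrow> ('v \<Rightarrow> complex) \<Rightarrow> ('e \<Rightarrow> real \<Rightarrow> complex) \<Rightarrow> bool" where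
  "planar_embedding G p \<gamma> \<longleftrightarrow>
     inj_on p (verts G) \<and>
     (\<forall>e\<in>arcs G. simple_path (\<gamma> e) \<and> pathstart (\<gamma> e) = p (tail G e) \<and>
        pathfinish (\<gamma> e) = p (head G e) \<and> \<gamma> e ` {0<..<1} \<inter> p ` verts G = {}) \<and>
     (\<forall>e\<in>arcs G. \<forall>f\<in>arcs G. e \<noteq> f \<longrightarrow> \<gamma> e ` {0<..<1} \<inter> \<gamma> f ` {0<..<1} = {})"

definition planar :: "('v, 'e, 'z) pre_digraph_scheme \<Rightarrow> bool" where
  "planar G \<longleftrightarrow> (\<exists>p \<gamma>. planar_embedding G p \<gamma>)"

end

theory Submission
  imports Defs
begin

text \<open>
  The 1-skeleton of \<open>\<Lambda>\<close> contains the graph of a four-dimensional cube, and that graph is not planar.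

  Call a vertex terminal if it is not the source of any edge.  In a singly connected graph only the
  identities are endomorphisms, so morphisms of nonzero degree define a strict order on the finitely
  many vertices, and some terminal vertex \<open>v\<close> is the range of an edge
  (\<open>exists_terminal_receiver\<close>).  In any commuting square containing an edge with terminal range, that
  range is the range of the whole square, so non-degeneracy makes \<open>v\<close> receive edges of every colour
  (\<open>terminal_receives_all_colours\<close>).  Local convexity then composes them into a morphism whose degree
  is the sum of four generators (\<open>cube_morphism\<close>).  Its initial segments end in the 16 vertices of a
  cube; these are distinct, because two initial segments with the same source would be parallel
  morphisms of different degrees (\<open>cube_in_skeleton\<close>).

  For the topological part, the 4-cube contains a subdivided \<open>K\<^sub>3\<^sub>,\<^sub>3\<close>: the vertices \<open>{1, 2, 3}\<close> and
  \<open>{}\<close> are joined by three internally disjoint paths, and the vertex \<open>{4}\<close> is joined, off these paths,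
  to an interior vertex of each of them.  This is impossible in the plane by \<open>theta_complement_closure\<close>: a connected
  set in the complement of a theta curve cannot accumulate at interior points of all three arcs.
  The latter follows from the Jordan curve theorem and Janiszewski's theorem.
\<close>

section \<open>Theta graphs in the plane\<close>

lemma connected_Un_closure_point:
  assumes "connected S" "connected T" "x \<in> closure S" "x \<in> T"
  shows "connected (S \<union> T)"
proof -
  have "connected (insert x S)"
    using assms closure_subset by (intro connected_intermediate_closure[OF assms(1)]) auto
  then have "connected (insert x S \<union> T)"
    using assms by (intro connected_Un) auto
  then show ?thesis using assms(4) by (simp add: insert_absorb)
qed

lemma path_image_subset_closure_open_arc:
  assumes "path c"
  shows "path_image c \<subseteq> closure (c ` {0<..<1})"
proof -
  have "c ` closure {0<..<1} \<subseteq> closure (c ` {0<..<1})"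
    using assms by (intro image_closure_subset) (auto simp: path_def intro: closure_subset[THEN subsetD])
  then show ?thesis by (simp add: path_image_def)
qed

text \<open>
  Let \<open>D\<close> be the side of the Jordan curve formed by the first two arcs that does not contain \<open>S\<close>.
  If \<open>S\<close> reached all three arcs, then \<open>D\<close> and \<open>S\<close> could be connected through the second arc without
  meeting the other two, and likewise through the first.  As the third arc is connected, Janiszewski's
  theorem would show that the whole theta curve does not separate \<open>D\<close> from \<open>S\<close>, whereas its first
  two arcs already do.
\<close>

lemma theta_complement_closure:
  fixes c1 c2 c3 :: "real \<Rightarrow> complex"
  assumes arcs: "arc c1" "arc c2" "arc c3"
    and start: "pathstart c1 = a" "pathstart c2 = a" "pathstart c3 = a"
    and finish: "pathfinish c1 = b" "pathfinish c2 = b" "pathfinish c3 = b"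
    and meet12: "path_image c1 \<inter> path_image c2 \<subseteq> {a, b}"
    and meet13: "path_image c1 \<inter> path_image c3 \<subseteq> {a, b}"
    and meet23: "path_image c2 \<inter> path_image c3 \<subseteq> {a, b}"
    and S: "connected S" "S \<inter> (path_image c1 \<union> path_image c2 \<union> path_image c3) = {}"
    and b1: "b1 \<in> closure S" "b1 \<in> path_image c1 - {a, b}"
    and b2: "b2 \<in> closure S" "b2 \<in> path_image c2 - {a, b}"
    and b3: "b3 \<in> closure S" "b3 \<in> path_image c3 - {a, b}"
  shows False
proof -
  have ends: "{a, b} \<subseteq> path_image c1" "{a, b} \<subseteq> path_image c2" "{a, b} \<subseteq> path_image c3"
    using start finish pathstart_in_path_image pathfinish_in_path_image
    by (metis empty_subsetI insert_subset)+
  have con: "connected (path_image c - {a, b})"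
    if "arc c" "pathstart c = a" "pathfinish c = b" for c :: "real \<Rightarrow> complex"
    using connected_simple_path_endless[OF arc_imp_simple_path[OF that(1)]] that by simp
  have S1: "connected (S \<union> (path_image c1 - {a, b}))"
    and S2: "connected (S \<union> (path_image c2 - {a, b}))"
    and S3: "connected (S \<union> (path_image c3 - {a, b}))"
    using connected_Un_closure_point[OF S(1) con[OF arcs(1) start(1) finish(1)] b1]
      connected_Un_closure_point[OF S(1) con[OF arcs(2) start(2) finish(2)] b2]
      connected_Un_closure_point[OF S(1) con[OF arcs(3) start(3) finish(3)] b3] .
  have "S \<noteq> {}" using b1 by auto
  then obtain q where q: "q \<in> S" by blast
  let ?C = "path_image c1 \<union> path_image c2"
  have "simple_path (c1 +++ reversepath c2)"
    using arcs start finish meet12 by (intro simple_path_join_loop) (auto simp: arc_reversepath)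
  moreover have "pathfinish (c1 +++ reversepath c2) = pathstart (c1 +++ reversepath c2)"
    using start by simp
  moreover have "path_image (c1 +++ reversepath c2) = ?C"
    using finish by (simp add: path_image_join)
  ultimately obtain U V where UV: "U \<noteq> {}" "open U" "connected U" "V \<noteq> {}" "open V" "connected V"
    "U \<inter> V = {}" "U \<union> V = - ?C" "frontier U = ?C" "frontier V = ?C"
    by (metis Jordan_curve)
  \<comment> \<open>The third open arc lies on the same side of this curve as \<open>S\<close>, so \<open>D\<close> below avoids it too.\<close>
  let ?S3 = "S \<union> (path_image c3 - {a, b})"
  have sub: "?S3 \<subseteq> U \<union> V" using UV(8) S(2) meet13 meet23 by blast
  have "U \<inter> ?S3 = {} \<or> V \<inter> ?S3 = {}"
    using connectedD[OF S3 UV(2,5)] sub UV(7) by blast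
  \<comment> \<open>The side of the curve that does not contain \<open>S\<close>.\<close>
  then obtain D where D: "D \<noteq> {}" "open D" "connected D" "frontier D = ?C" "D \<inter> ?S3 = {}"
    "D \<inter> ?C = {}" "\<And>x. x \<in> D \<Longrightarrow> \<not> connected_component (- ?C) x q"
  proof -
    have sep: False if AB: "x \<in> A" "y \<in> B" "connected_component (- ?C) x y" "open A" "open B"
      "A \<inter> B = {}" "A \<union> B = - ?C" for x y A B
    proof -
      obtain T where T: "connected T" "T \<subseteq> - ?C" "x \<in> T" "y \<in> T"
        using AB(3) unfolding connected_component_def by blast
      show False using connectedD[OF T(1) AB(4,5)] T AB by blast
    qed
    show thesis
    proof (cases "U \<inter> ?S3 = {}")
      case True
      then have qV: "q \<in> V" using q sub by blast
      have "U \<inter> ?C = {}" using UV(8) by blast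
      moreover have "\<not> connected_component (- ?C) x q" if "x \<in> U" for x
        using sep[OF that qV _ UV(2,5,7,8)] by blast
      ultimately show ?thesis using that[of U] UV True by blast
    next
      case False
      then have V: "V \<inter> ?S3 = {}" using \<open>U \<inter> ?S3 = {} \<or> V \<inter> ?S3 = {}\<close> by blast
      then have qU: "q \<in> U" using q sub by blast
      have "V \<inter> ?C = {}" using UV(8) by blast
      moreover have "\<not> connected_component (- ?C) x q" if "x \<in> V" for x
      proof
        have VU: "V \<inter> U = {}" "V \<union> U = - ?C" using UV(7,8) by blast+
        assume "connected_component (- ?C) x q"
        then show False by (rule sep[OF that qU _ UV(5,2) VU])
      qed
      ultimately show ?thesis using that[of V] UV V by blast
    qed
  qed
  obtain x where x: "x \<in> D" using D(1) by blast
  have "?C \<subseteq> closure D" using D(4) by (auto simp: frontier_def)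
  then have clb: "b1 \<in> closure D" "b2 \<in> closure D" using b1(2) b2(2) by blast+
  have open1: "(path_image c1 - {a, b}) \<inter> (path_image c2 \<union> path_image c3) = {}"
    using meet12 meet13 by blast
  have open2: "(path_image c2 - {a, b}) \<inter> (path_image c1 \<union> path_image c3) = {}"
    using meet12 meet23 by blast
  have "D \<inter> {a, b} = {}" using D(6) ends(1) by blast
  then have D_theta: "D \<inter> path_image c1 = {}" "D \<inter> path_image c2 = {}" "D \<inter> path_image c3 = {}"
    using D(5,6) by blast+
  \<comment> \<open>\<open>D\<close> and \<open>S\<close> are joined through each of the first two open arcs, hence off the two other
    curves.\<close>
  have "connected (D \<union> (S \<union> (path_image c2 - {a, b})))"
    by (rule connected_Un_closure_point[OF D(3) S2 clb(2)]) (use b2(2) in blast)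
  moreover have "D \<union> (S \<union> (path_image c2 - {a, b})) \<subseteq> - (path_image c1 \<union> path_image c3)"
    using D_theta S(2) open2 by auto
  ultimately have 13: "connected_component (- (path_image c1 \<union> path_image c3)) x q"
    using x q unfolding connected_component_def by blast
  have "connected (D \<union> (S \<union> (path_image c1 - {a, b})))"
    by (rule connected_Un_closure_point[OF D(3) S1 clb(1)]) (use b1(2) in blast)
  moreover have "D \<union> (S \<union> (path_image c1 - {a, b})) \<subseteq> - (path_image c2 \<union> path_image c3)"
    using D_theta S(2) open1 by auto
  ultimately have 23: "connected_component (- (path_image c2 \<union> path_image c3)) x q"
    using x q unfolding connected_component_def by blast
  have "(path_image c1 \<union> path_image c3) \<inter> (path_image c2 \<union> path_image c3) = path_image c3"
    using meet12 ends by blast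
  then have "connected ((path_image c1 \<union> path_image c3) \<inter> (path_image c2 \<union> path_image c3))"
    using arcs by (simp add: connected_arc_image)
  moreover have "compact (path_image c1 \<union> path_image c3)" "closed (path_image c2 \<union> path_image c3)"
    using arcs by (simp_all add: compact_Un compact_arc_image closed_Un closed_arc_image)
  ultimately have "connected_component
      (- ((path_image c1 \<union> path_image c3) \<union> (path_image c2 \<union> path_image c3))) x q"
    using Janiszewski 13 23 by blast
  then have "connected_component (- ?C) x q"
    by (rule connected_component_of_subset) blast
  then show False using D(7)[OF x] by blast
qed

section \<open>The four-dimensional cube is not planar\<close>

lemma planar_embedding_vertex_on_edge:
  assumes "planar_embedding G p \<gamma>" "\<forall>e\<in>arcs G. tail G e \<in> verts G \<and> head G e \<in> verts G"
    and "e \<in> arcs G" "v \<in> verts G"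
    and "p v \<in> path_image (\<gamma> e)"
  shows "v \<in> {tail G e, head G e}"
proof -
  have e: "simple_path (\<gamma> e)" "pathstart (\<gamma> e) = p (tail G e)" "pathfinish (\<gamma> e) = p (head G e)"
    "\<gamma> e ` {0<..<1} \<inter> p ` verts G = {}" and inj: "inj_on p (verts G)"
    using assms(1,3) by (auto simp: planar_embedding_def)
  have "p v \<notin> path_image (\<gamma> e) - {p (tail G e), p (head G e)}"
    using simple_path_endless[OF e(1)] e assms(4) by auto
  then show ?thesis
    using assms(4,5) inj_onD[OF inj] assms(2,3) by fastforce
qed

lemma planar_embedding_edges_meet:
  assumes "planar_embedding G p \<gamma>" "\<forall>e\<in>arcs G. tail G e \<in> verts G \<and> head G e \<in> verts G"
    and "e \<in> arcs G" "f \<in> arcs G" "e \<noteq> f"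
  shows "path_image (\<gamma> e) \<inter> path_image (\<gamma> f) \<subseteq> p ` ({tail G e, head G e} \<inter> {tail G f, head G f})"
proof
  fix x assume x: "x \<in> path_image (\<gamma> e) \<inter> path_image (\<gamma> f)"
  have *: "x \<in> \<gamma> g ` {0<..<1} \<or> x \<in> p ` {tail G g, head G g}"
    if "g \<in> arcs G" "x \<in> path_image (\<gamma> g)" for g
  proof -
    have "simple_path (\<gamma> g)" "pathstart (\<gamma> g) = p (tail G g)" "pathfinish (\<gamma> g) = p (head G g)"
      using assms(1) that by (auto simp: planar_embedding_def)
    then show ?thesis using simple_path_endless[of "\<gamma> g"] that by auto
  qed
  have "\<gamma> e ` {0<..<1} \<inter> \<gamma> f ` {0<..<1} = {}"
    using assms by (auto simp: planar_embedding_def)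
  then have "x \<in> p ` {tail G e, head G e} \<or> x \<in> p ` {tail G f, head G f}"
    using * assms(3,4) x by blast
  then obtain v where v: "x = p v" "v \<in> verts G"
    using assms(2-4) by blast
  then show "x \<in> p ` ({tail G e, head G e} \<inter> {tail G f, head G f})"
    using planar_embedding_vertex_on_edge[OF assms(1,2)] assms(3,4) x by blast
qed

text \<open>
  The vertices of the cube are the subsets of \<open>{1..4}\<close>, and \<open>E A i\<close> is the edge between \<open>insert i A\<close>
  and \<open>A\<close>; \<open>G\<close> may have further vertices and edges.
  The endpoint condition on \<open>G\<close> says that it is a well-formed digraph.
\<close>

lemma not_planar_four_cube:
  fixes P :: "nat set \<Rightarrow> 'v" and E :: "nat set \<Rightarrow> nat \<Rightarrow> 'e"
  assumes wf: "\<forall>e\<in>arcs G. tail G e \<in> verts G \<and> head G e \<in> verts G"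
    and inj: "inj_on P (Pow {1..4})"
    and verts: "\<And>A. A \<subseteq> {1..4} \<Longrightarrow> P A \<in> verts G"
    and edge: "\<And>A i. A \<subseteq> {1..4} \<Longrightarrow> i \<in> {1..4} - A \<Longrightarrow>
      E A i \<in> arcs G \<and> tail G (E A i) = P (insert i A) \<and> head G (E A i) = P A"
  shows "\<not> planar G"
proof
  assume "planar G"
  then obtain p \<gamma> where emb: "planar_embedding G p \<gamma>" by (auto simp: planar_def)
  \<comment> \<open>The drawn cube: \<open>Q A\<close> is the point of the vertex \<open>A\<close>, and \<open>\<Gamma> (A, i)\<close> is the curve of the edge
    \<open>(A, i)\<close>, which runs from \<open>Q (insert i A)\<close> to \<open>Q A\<close>.\<close>
  define Q where "Q A = p (P A)" for A
  define \<Gamma> where "\<Gamma> = (\<lambda>(A, i). \<gamma> (E A i))"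
  define cube_edges where "cube_edges = {(A, i). A \<subseteq> {1..4::nat} \<and> i \<in> {1..4} - A}"
  define ends :: "nat set \<times> nat \<Rightarrow> nat set set" where "ends = (\<lambda>(A, i). {insert i A, A})"
  have pinj: "inj_on p (verts G)" using emb by (simp add: planar_embedding_def)
  have Pinj: "P A = P B \<longleftrightarrow> A = B" if "A \<subseteq> {1..4}" "B \<subseteq> {1..4}" for A B
    using inj that by (auto dest: inj_onD)
  have Qinj: "Q A = Q B \<longleftrightarrow> A = B" if "A \<subseteq> {1..4}" "B \<subseteq> {1..4}" for A B
    unfolding Q_def using that inj_on_eq_iff[OF pinj verts verts] Pinj by simp
  have ends_sub: "A \<subseteq> {1..4}" if "A \<in> ends e" "e \<in> cube_edges" for A e
    using that by (auto simp: ends_def cube_edges_def)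
  have arc\<Gamma>: "arc (\<Gamma> (A, i))" and start\<Gamma>: "pathstart (\<Gamma> (A, i)) = Q (insert i A)"
    and finish\<Gamma>: "pathfinish (\<Gamma> (A, i)) = Q A" if "(A, i) \<in> cube_edges" for A i
  proof -
    have A: "A \<subseteq> {1..4}" "i \<in> {1..4}" "i \<notin> A" using that by (auto simp: cube_edges_def)
    have e: "E A i \<in> arcs G" "tail G (E A i) = P (insert i A)" "head G (E A i) = P A"
      using edge[of A i] A by auto
    show s: "pathstart (\<Gamma> (A, i)) = Q (insert i A)" and f: "pathfinish (\<Gamma> (A, i)) = Q A"
      using emb e by (auto simp: planar_embedding_def \<Gamma>_def Q_def)
    have "Q (insert i A) \<noteq> Q A" using A Qinj[of "insert i A" A] by auto
    moreover have "simple_path (\<Gamma> (A, i))"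
      using emb e by (auto simp: planar_embedding_def \<Gamma>_def)
    ultimately show "arc (\<Gamma> (A, i))" using s f by (simp add: arc_simple_path)
  qed
  have on_edge: "A \<in> ends e" if "Q A \<in> path_image (\<Gamma> e)" "e \<in> cube_edges" "A \<subseteq> {1..4}" for A e
  proof -
    obtain B i where e: "e = (B, i)" by force
    have B: "B \<subseteq> {1..4}" "i \<in> {1..4} - B" using that e by (auto simp: cube_edges_def)
    have "P A \<in> {tail G (E B i), head G (E B i)}"
      using planar_embedding_vertex_on_edge[OF emb wf _ verts[OF that(3)], of "E B i"]
        edge[OF B] that(1) e by (simp add: Q_def \<Gamma>_def)
    then have "P A = P (insert i B) \<or> P A = P B" using edge[OF B] by auto
    then show ?thesis
      using Pinj[OF that(3), of "insert i B"] Pinj[OF that(3), of B] B e by (auto simp: ends_def)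
  qed
  have meet: "path_image (\<Gamma> e) \<inter> path_image (\<Gamma> f) \<subseteq> Q ` (ends e \<inter> ends f)"
    if "e \<in> cube_edges" "f \<in> cube_edges" "e \<noteq> f" for e f
  proof -
    obtain A i B j where ef: "e = (A, i)" "f = (B, j)" by force
    have A: "A \<subseteq> {1..4}" "i \<in> {1..4} - A" and B: "B \<subseteq> {1..4}" "j \<in> {1..4} - B"
      using that ef by (auto simp: cube_edges_def)
    have "E A i \<noteq> E B j"
    proof
      assume "E A i = E B j"
      then have "P A = P B" "P (insert i A) = P (insert j B)"
        using edge[OF A] edge[OF B] by auto
      then have "A = B" "insert i A = insert j B"
        using Pinj[of A B] Pinj[of "insert i A" "insert j B"] A B by auto
      then show False using A B that(3) ef by blast
    qed
    then have "path_image (\<Gamma> e) \<inter> path_image (\<Gamma> f)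
        \<subseteq> p ` ({P (insert i A), P A} \<inter> {P (insert j B), P B})"
      using planar_embedding_edges_meet[OF emb wf, of "E A i" "E B j"] edge[OF A] edge[OF B]
      by (simp add: \<Gamma>_def ef)
    also have "{P (insert i A), P A} \<inter> {P (insert j B), P B} = P ` (ends e \<inter> ends f)"
      using inj_on_image_Int[OF inj, of "ends e" "ends f"] A B by (simp add: ends_def ef)
    finally show ?thesis by (simp add: Q_def image_image)
  qed
  have meet_sets: "(\<Union>e\<in>M. path_image (\<Gamma> e)) \<inter> (\<Union>f\<in>N. path_image (\<Gamma> f))
      \<subseteq> Q ` (\<Union>(ends ` M) \<inter> \<Union>(ends ` N))"
    if "M \<subseteq> cube_edges" "N \<subseteq> cube_edges" "M \<inter> N = {}" for M N
  proof
    fix x assume "x \<in> (\<Union>e\<in>M. path_image (\<Gamma> e)) \<inter> (\<Union>f\<in>N. path_image (\<Gamma> f))"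
    then obtain e f where ef: "e \<in> M" "f \<in> N" "x \<in> path_image (\<Gamma> e) \<inter> path_image (\<Gamma> f)"
      by blast
    then have "e \<in> cube_edges" "f \<in> cube_edges" "e \<noteq> f" using that by auto
    then have "x \<in> Q ` (ends e \<inter> ends f)" using meet ef(3) by (meson subsetD)
    then show "x \<in> Q ` (\<Union>(ends ` M) \<inter> \<Union>(ends ` N))" using ef(1,2) by auto
  qed
  \<comment> \<open>The three paths of the theta graph from \<open>{1, 2, 3}\<close> to \<open>{}\<close>.  They lie in the face of the
    first three directions and are numbered by the cyclic permutations \<open>(i, j, l)\<close> of \<open>(1, 2, 3)\<close>.\<close>
  define leg where "leg i j l = \<Gamma> ({i, j}, l) +++ (\<Gamma> ({i}, j) +++ \<Gamma> ({}, i))" for i j l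
  define L where "L i j l = {({i, j}, l), ({i}, j), ({}, i)}" for i j l :: nat
  define T where "T = {(1::nat, 2::nat, 3::nat), (2, 3, 1), (3, 1, 2)}"
  have L: "L i j l \<subseteq> cube_edges" "\<Union>(ends ` L i j l) = {{1,2,3}, {i, j}, {i}, {}}"
    if "(i, j, l) \<in> T" for i j l
    using that by (auto simp: L_def cube_edges_def ends_def T_def)
  have leg: "arc (leg i j l)" "pathstart (leg i j l) = Q {1,2,3}" "pathfinish (leg i j l) = Q {}"
    "path_image (leg i j l) = (\<Union>e\<in>L i j l. path_image (\<Gamma> e))" if t: "(i, j, l) \<in> T" for i j l
  proof -
    have d: "i \<noteq> j" "i \<noteq> l" "j \<noteq> l" "{l, i, j} = {1,2,3}" using t by (auto simp: T_def)
    have e: "({i, j}, l) \<in> cube_edges" "({i}, j) \<in> cube_edges" "({}, i) \<in> cube_edges"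
      using L(1)[OF t] by (auto simp: L_def)
    have ij: "{j, i} = {i, j}" by blast
    have m1: "path_image (\<Gamma> ({i}, j)) \<inter> path_image (\<Gamma> ({}, i)) \<subseteq> {Q {i}}"
      using meet[OF e(2,3)] d by (auto simp: ends_def)
    have m2: "path_image (\<Gamma> ({i, j}, l)) \<inter> path_image (\<Gamma> ({i}, j)) \<subseteq> {Q {i, j}}"
      using meet[OF e(1,2)] d by (auto simp: ends_def ij)
    have m3: "path_image (\<Gamma> ({i, j}, l)) \<inter> path_image (\<Gamma> ({}, i)) \<subseteq> {}"
      using meet[OF e(1,3)] d by (auto simp: ends_def)
    have a: "arc (\<Gamma> ({i}, j) +++ \<Gamma> ({}, i))"
      using e m1 by (intro arc_join) (auto simp: arc\<Gamma> start\<Gamma> finish\<Gamma>)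
    have im: "path_image (\<Gamma> ({i}, j) +++ \<Gamma> ({}, i)) = path_image (\<Gamma> ({i}, j)) \<union> path_image (\<Gamma> ({}, i))"
      using e by (intro path_image_join) (auto simp: start\<Gamma> finish\<Gamma>)
    show "arc (leg i j l)" unfolding leg_def
    proof (rule arc_join[OF arc\<Gamma>[OF e(1)] a])
      show "pathfinish (\<Gamma> ({i, j}, l)) = pathstart (\<Gamma> ({i}, j) +++ \<Gamma> ({}, i))"
        using e by (simp add: start\<Gamma> finish\<Gamma> ij)
      show "path_image (\<Gamma> ({i, j}, l)) \<inter> path_image (\<Gamma> ({i}, j) +++ \<Gamma> ({}, i))
          \<subseteq> {pathstart (\<Gamma> ({i}, j) +++ \<Gamma> ({}, i))}"
        unfolding im using m2 m3 e by (auto simp: start\<Gamma> ij)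
    qed
    show "pathstart (leg i j l) = Q {1,2,3}" "pathfinish (leg i j l) = Q {}"
      using e d by (auto simp: leg_def start\<Gamma> finish\<Gamma>)
    show "path_image (leg i j l) = (\<Union>e\<in>L i j l. path_image (\<Gamma> e))"
      unfolding leg_def
      by (subst path_image_join) (use e in \<open>auto simp: im start\<Gamma> finish\<Gamma> ij L_def\<close>)
  qed
  have legs_meet: "path_image (leg i j l) \<inter> path_image (leg i' j' l') \<subseteq> {Q {1,2,3}, Q {}}"
    if t: "(i, j, l) \<in> T" "(i', j', l') \<in> T" and ne: "i \<noteq> i'" for i j l i' j' l'
  proof -
    have ij: "i \<noteq> j" "i' \<noteq> j'" "{i, j} \<noteq> {i', j'}"
      using t ne by (auto simp: T_def doubleton_eq_iff)
    then have "{i, j} \<noteq> {i'}" "{i} \<noteq> {i', j'}" by auto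
    then have "L i j l \<inter> L i' j' l' = {}"
      and "{{1,2,3}, {i, j}, {i}, {}} \<inter> {{1,2,3}, {i', j'}, {i'}, {}} \<subseteq> {{1,2,3}, {}}"
      using ij ne by (simp_all add: L_def)
    then have "path_image (leg i j l) \<inter> path_image (leg i' j' l') \<subseteq> Q ` {{1,2,3}, {}}"
      using meet_sets[OF L(1)[OF t(1)] L(1)[OF t(2)]]
      unfolding leg(4)[OF t(1)] leg(4)[OF t(2)] L(2)[OF t(1)] L(2)[OF t(2)]
      by (meson image_mono order_trans)
    then show ?thesis by simp
  qed
  \<comment> \<open>The star centred at \<open>{4}\<close>, each ray of which stops just short of the vertex \<open>{i}\<close> on the
    theta graph.\<close>
  define ray where "ray i = path_image (\<Gamma> ({4}, i)) \<union> (path_image (\<Gamma> ({i}, 4)) - {Q {i}})" for i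
  define S where "S = (\<Union>i\<in>{1,2,3}. ray i)"
  have ray: "connected (ray i)" "Q {4} \<in> ray i" "Q {i} \<in> closure (ray i)" if i: "i \<in> {1,2,3}" for i
  proof -
    have e: "({4}, i) \<in> cube_edges" "({i}, 4) \<in> cube_edges" using i by (auto simp: cube_edges_def)
    have c: "connected (path_image (\<Gamma> ({4}, i)))"
      using arc\<Gamma>[OF e(1)] by (simp add: connected_arc_image)
    have open_arc: "\<Gamma> ({i}, 4) ` {0<..<1} = path_image (\<Gamma> ({i}, 4)) - {Q {4, i}, Q {i}}"
      using simple_path_endless[OF arc_imp_simple_path[OF arc\<Gamma>[OF e(2)]]]
      by (simp add: start\<Gamma>[OF e(2)] finish\<Gamma>[OF e(2)])
    have cl: "path_image (\<Gamma> ({i}, 4)) \<subseteq> closure (\<Gamma> ({i}, 4) ` {0<..<1})"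
      using arc\<Gamma>[OF e(2)] by (intro path_image_subset_closure_open_arc) (rule arc_imp_path)
    have c': "connected (path_image (\<Gamma> ({i}, 4)) - {Q {i}})"
    proof (rule connected_intermediate_closure)
      show "connected (\<Gamma> ({i}, 4) ` {0<..<1})"
        using arc\<Gamma>[OF e(2)] by (metis arc_imp_simple_path connected_simple_path_endless simple_path_endless)
      show "\<Gamma> ({i}, 4) ` {0<..<1} \<subseteq> path_image (\<Gamma> ({i}, 4)) - {Q {i}}"
        using open_arc by blast
      show "path_image (\<Gamma> ({i}, 4)) - {Q {i}} \<subseteq> closure (\<Gamma> ({i}, 4) ` {0<..<1})"
        using cl by blast
    qed
    have "Q {4, i} \<in> path_image (\<Gamma> ({i}, 4))" "Q {i, 4} \<in> path_image (\<Gamma> ({4}, i))"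
      "Q {i} \<in> path_image (\<Gamma> ({i}, 4))"
      using pathstart_in_path_image start\<Gamma>[OF e(1)] start\<Gamma>[OF e(2)]
        pathfinish_in_path_image finish\<Gamma>[OF e(2)] by metis+
    moreover have "Q {4, i} \<noteq> Q {i}" using Qinj[of "{4, i}" "{i}"] i by auto
    ultimately have "Q {4, i} \<in> path_image (\<Gamma> ({4}, i)) \<inter> (path_image (\<Gamma> ({i}, 4)) - {Q {i}})"
      by (simp add: insert_commute)
    then show "connected (ray i)"
      unfolding ray_def by (intro connected_Un[OF c c']) blast
    show "Q {4} \<in> ray i"
      using pathfinish_in_path_image finish\<Gamma>[OF e(1)] unfolding ray_def by (metis UnI1)
    have "\<Gamma> ({i}, 4) ` {0<..<1} \<subseteq> ray i"
      using open_arc by (auto simp: ray_def)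
    then show "Q {i} \<in> closure (ray i)"
      using cl closure_mono \<open>Q {i} \<in> path_image (\<Gamma> ({i}, 4))\<close> by blast
  qed
  have S_connected: "connected S"
    unfolding S_def
  proof (rule connected_Union)
    have "Q {4} \<in> \<Inter> (ray ` {1,2,3})" using ray(2) by blast
    then show "\<Inter> (ray ` {1,2,3}) \<noteq> {}" by blast
  qed (use ray(1) in blast)
  have S_closure: "Q {i} \<in> closure S" if "i \<in> {1,2,3}" for i
    using ray(3)[OF that] closure_mono[of "ray i" S] that unfolding S_def by blast
  have S_disjoint: "S \<inter> path_image (leg i j l) = {}" if t: "(i, j, l) \<in> T" for i j l
  proof (rule ccontr)
    assume "S \<inter> path_image (leg i j l) \<noteq> {}"
    then obtain x m where x: "x \<in> ray m" "x \<in> path_image (leg i j l)" and m: "m \<in> {1,2,3}"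
      by (auto simp: S_def)
    have e: "{({4}, m), ({m}, 4)} \<subseteq> cube_edges" using m by (auto simp: cube_edges_def)
    have "{({4}, m), ({m}, 4)} \<inter> L i j l = {}"
      using m t by (auto simp: L_def T_def)
    then have "x \<in> Q ` (\<Union>(ends ` {({4}, m), ({m}, 4)}) \<inter> {{1,2,3}, {i, j}, {i}, {}})"
      using meet_sets[OF e L(1)[OF t]] x unfolding leg(4)[OF t] L(2)[OF t] ray_def by blast
    then obtain A where A: "x = Q A" "A \<in> {{4}, {m, 4}, {m}}" "A \<in> {{1,2,3}, {i, j}, {i}, {}}"
      by (auto simp: ends_def insert_commute)
    have "4 \<notin> {1,2,3::nat}" "4 \<notin> {i, j}" using t by (auto simp: T_def)
    then have "4 \<notin> A" using A(3) by blast
    then have "x = Q {m}" using A(1,2) by blast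
    with x(1) have "Q {m} \<in> path_image (\<Gamma> ({4}, m))" by (auto simp: ray_def)
    then have "{m} \<in> ends ({4}, m)" using on_edge[of "{m}"] e m by auto
    then show False using m by (auto simp: ends_def)
  qed
  have on_leg: "Q {i} \<in> path_image (leg i j l) - {Q {1,2,3}, Q {}}" if t: "(i, j, l) \<in> T" for i j l
  proof -
    have "({}, i) \<in> cube_edges" using L(1)[OF t] by (auto simp: L_def)
    then have "Q {i} \<in> path_image (\<Gamma> ({}, i))"
      using start\<Gamma> pathstart_in_path_image by metis
    then have "Q {i} \<in> path_image (leg i j l)" unfolding leg(4)[OF t] by (auto simp: L_def)
    moreover have "Q {i} \<noteq> Q {1,2,3}" "Q {i} \<noteq> Q {}"
    proof -
      have "i \<in> {1,2,3}" "j \<in> {1,2,3}" "j \<noteq> i" using t by (auto simp: T_def)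
      moreover from this have "{i} \<noteq> {1,2,3}" by blast
      ultimately show "Q {i} \<noteq> Q {1,2,3}" "Q {i} \<noteq> Q {}"
        using Qinj[of "{i}" "{1,2,3}"] Qinj[of "{i}" "{}"] by auto
    qed
    ultimately show ?thesis by blast
  qed
  have t: "(1, 2, 3) \<in> T" "(2, 3, 1) \<in> T" "(3, 1, 2) \<in> T" by (auto simp: T_def)
  show False
    by (rule theta_complement_closure[OF leg(1)[OF t(1)] leg(1)[OF t(2)] leg(1)[OF t(3)]
        leg(2)[OF t(1)] leg(2)[OF t(2)] leg(2)[OF t(3)] leg(3)[OF t(1)] leg(3)[OF t(2)] leg(3)[OF t(3)]
        legs_meet[OF t(1,2)] legs_meet[OF t(1,3)] legs_meet[OF t(2,3)] S_connected _
        S_closure on_leg[OF t(1)] S_closure on_leg[OF t(2)] S_closure on_leg[OF t(3)]])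
      (use S_disjoint t in auto)
qed

section \<open>Cubes in higher-rank graphs\<close>

lemma lookup_sum_eps:
  "finite A \<Longrightarrow> Poly_Mapping.lookup (sum eps A) j = (if j \<in> A then 1 else 0)"
  by (simp add: lookup_sum eps_def lookup_single when_def)

lemma sum_eps_inject:
  assumes "finite A" "finite B" "sum eps A = sum eps B"
  shows "A = B"
  using lookup_sum_eps[OF assms(1)] lookup_sum_eps[OF assms(2)] assms(3)
  by (metis one_neq_zero subsetI subset_antisym)

context k_graph
begin

lemma of_degreeD: "\<kappa> \<in> of_degree \<Lambda> m \<Longrightarrow> \<kappa> \<in> Mor \<Lambda> \<and> deg \<Lambda> \<kappa> = m"
  by (simp add: of_degree_def)

lemma factor:
  assumes "\<kappa> \<in> of_degree \<Lambda> (m + n)"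
  obtains \<mu> \<nu> where "\<mu> \<in> of_degree \<Lambda> m" "\<nu> \<in> of_degree \<Lambda> n" "src \<Lambda> \<mu> = rng \<Lambda> \<nu>" "\<kappa> = \<mu> \<star> \<nu>"
proof -
  have \<kappa>: "\<kappa> \<in> Mor \<Lambda>" "deg \<Lambda> \<kappa> = m + n" using assms by (auto simp: of_degree_def)
  have "Poly_Mapping.keys (m + n) = Poly_Mapping.keys m \<union> Poly_Mapping.keys n"
    by (auto simp: in_keys_iff lookup_add)
  then have "m \<in> Nk k" "n \<in> Nk k" using deg_in[OF \<kappa>(1)] \<kappa>(2) by (auto simp: Nk_def)
  from factorisation[OF \<kappa>(1) this \<kappa>(2)] show ?thesis
    using that by (auto simp: of_degree_def elim!: ex1E)
qed

text \<open>Uniqueness is only needed for the initial factor.\<close>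

lemma factor_unique:
  assumes "\<mu> \<in> of_degree \<Lambda> m" "\<nu> \<in> of_degree \<Lambda> n" "src \<Lambda> \<mu> = rng \<Lambda> \<nu>"
    and "\<mu>' \<in> of_degree \<Lambda> m" "\<nu>' \<in> of_degree \<Lambda> n" "src \<Lambda> \<mu>' = rng \<Lambda> \<nu>'"
    and "\<mu> \<star> \<nu> = \<mu>' \<star> \<nu>'"
  shows "\<mu> = \<mu>'"
proof -
  have *: "\<mu> \<star> \<nu> \<in> Mor \<Lambda>" "deg \<Lambda> (\<mu> \<star> \<nu>) = m + n" "m \<in> Nk k" "n \<in> Nk k"
    using assms(1-3) cmp_in deg_cmp deg_in by (auto simp: of_degree_def)
  from factorisation[OF *(1,3,4,2)]
  have "\<And>x y. (case x of (\<mu>', \<nu>') \<Rightarrow> \<mu>' \<in> Mor \<Lambda> \<and> \<nu>' \<in> Mor \<Lambda> \<and> src \<Lambda> \<mu>' = rng \<Lambda> \<nu>' \<and>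
      deg \<Lambda> \<mu>' = m \<and> deg \<Lambda> \<nu>' = n \<and> \<mu> \<star> \<nu> = \<mu>' \<star> \<nu>') \<Longrightarrow>
    (case y of (\<mu>', \<nu>') \<Rightarrow> \<mu>' \<in> Mor \<Lambda> \<and> \<nu>' \<in> Mor \<Lambda> \<and> src \<Lambda> \<mu>' = rng \<Lambda> \<nu>' \<and>
      deg \<Lambda> \<mu>' = m \<and> deg \<Lambda> \<nu>' = n \<and> \<mu> \<star> \<nu> = \<mu>' \<star> \<nu>') \<Longrightarrow> x = y"
    by (metis (no_types, lifting))
  from this[of "(\<mu>, \<nu>)" "(\<mu>', \<nu>')"] show ?thesis using assms by (simp add: of_degree_def)
qed

lemma cmp_of_degree:
  assumes "\<mu> \<in> of_degree \<Lambda> m" "\<nu> \<in> of_degree \<Lambda> n" "src \<Lambda> \<mu> = rng \<Lambda> \<nu>"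
  shows "\<mu> \<star> \<nu> \<in> of_degree \<Lambda> (m + n)"
  using assms by (simp add: of_degree_def cmp_in deg_cmp)

lemma rng_vertex: "\<kappa> \<in> Mor \<Lambda> \<Longrightarrow> rng \<Lambda> \<kappa> \<in> vertices \<Lambda>"
  and src_vertex: "\<kappa> \<in> Mor \<Lambda> \<Longrightarrow> src \<Lambda> \<kappa> \<in> vertices \<Lambda>"
  by (simp_all add: vertices_eq_objects rng_object src_object)

lemma parallel_eq:
  assumes "singly_connected \<Lambda>" "\<mu> \<in> Mor \<Lambda>" "\<nu> \<in> Mor \<Lambda>" "rng \<Lambda> \<mu> = rng \<Lambda> \<nu>" "src \<Lambda> \<mu> = src \<Lambda> \<nu>"
  shows "\<mu> = \<nu>"
proof -
  let ?H = "hom_set \<Lambda> (rng \<Lambda> \<mu>) (src \<Lambda> \<mu>)"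
  have "finite ?H" "card ?H \<le> 1"
    using assms rng_vertex src_vertex by (auto simp: singly_connected_def)
  moreover have "\<mu> \<in> ?H" "\<nu> \<in> ?H" using assms by (auto simp: hom_set_def)
  ultimately show ?thesis by (metis card_le_Suc0_iff_eq One_nat_def)
qed

text \<open>
  Choose an edge into \<open>v\<close> of one of the colours; by local convexity its source again receives edges of
  all the remaining colours, so the rest of the cube can be attached there by induction.
\<close>

lemma cube_morphism:
  assumes "locally_convex k \<Lambda>"
  shows "finite I \<Longrightarrow> I \<subseteq> {1..k} \<Longrightarrow> v \<in> vertices \<Lambda> \<Longrightarrow> \<forall>i\<in>I. \<exists>e\<in>edges \<Lambda> i. rng \<Lambda> e = v \<Longrightarrow>
    \<exists>\<kappa>\<in>of_degree \<Lambda> (sum eps I). rng \<Lambda> \<kappa> = v"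
proof (induction I arbitrary: v rule: finite_induct)
  case empty
  then show ?case by (auto simp: vertices_eq_objects objects_def intro!: bexI[of _ v])
next
  case (insert i J)
  then obtain e where e: "e \<in> edges \<Lambda> i" "rng \<Lambda> e = v" by auto
  have "\<exists>f'\<in>edges \<Lambda> j. rng \<Lambda> f' = src \<Lambda> e" if j: "j \<in> J" for j
  proof -
    obtain f where f: "f \<in> edges \<Lambda> j" "rng \<Lambda> f = v" using insert.prems j by auto
    have "i \<noteq> j" "i \<in> {1..k}" "j \<in> {1..k}" using insert j by auto
    then show ?thesis using assms e f unfolding locally_convex_def by metis
  qed
  moreover have "src \<Lambda> e \<in> vertices \<Lambda>" using e of_degreeD src_vertex by blast
  ultimately obtain \<kappa> where \<kappa>: "\<kappa> \<in> of_degree \<Lambda> (sum eps J)" "rng \<Lambda> \<kappa> = src \<Lambda> e"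
    using insert.IH[of "src \<Lambda> e"] insert.prems(1) by auto
  then have "e \<star> \<kappa> \<in> of_degree \<Lambda> (sum eps (insert i J))"
    using cmp_of_degree[OF e(1) \<kappa>(1)] insert by simp
  moreover have "rng \<Lambda> (e \<star> \<kappa>) = v"
    using rng_cmp e \<kappa> of_degreeD by metis
  ultimately show ?case by blast
qed

text \<open>
  \<open>P A\<close> is the source of the initial segment of \<open>\<kappa>\<close> of degree \<open>sum eps A\<close>, and \<open>E A i\<close> is the edge that
  extends the segment for \<open>A\<close> to the one for \<open>insert i A\<close>.
\<close>

lemma cube_in_skeleton:
  assumes sc: "singly_connected \<Lambda>" and I: "finite I"
    and \<kappa>: "\<kappa> \<in> of_degree \<Lambda> (sum eps I)"
  obtains P E where "inj_on P (Pow I)" "\<And>A. A \<subseteq> I \<Longrightarrow> P A \<in> vertices \<Lambda>"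
    "\<And>A i. A \<subseteq> I \<Longrightarrow> i \<in> I - A \<Longrightarrow>
      E A i \<in> edges \<Lambda> i \<and> src \<Lambda> (E A i) = P (insert i A) \<and> rng \<Lambda> (E A i) = P A"
proof -
  define prefix where "prefix A \<mu> \<longleftrightarrow> \<mu> \<in> of_degree \<Lambda> (sum eps A) \<and>
    (\<exists>\<nu>\<in>of_degree \<Lambda> (sum eps (I - A)). src \<Lambda> \<mu> = rng \<Lambda> \<nu> \<and> \<kappa> = \<mu> \<star> \<nu>)" for A \<mu>
  have ex: "\<exists>\<mu>. prefix A \<mu>" if "A \<subseteq> I" for A
  proof -
    have "sum eps I = sum eps A + sum eps (I - A)"
      using I that by (metis add.commute sum.subset_diff)
    then show ?thesis using factor[of \<kappa> "sum eps A" "sum eps (I - A)"] \<kappa> unfolding prefix_def by metis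
  qed
  define M where "M A = (SOME \<mu>. prefix A \<mu>)" for A
  have M: "prefix A (M A)" if "A \<subseteq> I" for A
    unfolding M_def using someI_ex[OF ex[OF that]] .
  have deg_M: "M A \<in> Mor \<Lambda>" "deg \<Lambda> (M A) = sum eps A" and rng_M: "rng \<Lambda> (M A) = rng \<Lambda> \<kappa>"
    if "A \<subseteq> I" for A
    using M[OF that] rng_cmp unfolding prefix_def by (auto simp: of_degree_def)
  have "\<exists>e. e \<in> edges \<Lambda> i \<and> src \<Lambda> e = src \<Lambda> (M (insert i A)) \<and> rng \<Lambda> e = src \<Lambda> (M A)"
    if A: "A \<subseteq> I" "i \<in> I - A" for A i
  proof -
    have fin: "finite A" using A I finite_subset by blast
    have "prefix (insert i A) (M (insert i A))" using A M by blast
    then obtain \<nu> where \<nu>: "M (insert i A) \<in> of_degree \<Lambda> (sum eps A + eps i)"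
      "\<nu> \<in> of_degree \<Lambda> (sum eps (I - insert i A))" "src \<Lambda> (M (insert i A)) = rng \<Lambda> \<nu>"
      "\<kappa> = M (insert i A) \<star> \<nu>"
      using fin A by (auto simp: prefix_def add.commute)
    obtain \<mu> e where e: "\<mu> \<in> of_degree \<Lambda> (sum eps A)" "e \<in> edges \<Lambda> i" "src \<Lambda> \<mu> = rng \<Lambda> e"
      "M (insert i A) = \<mu> \<star> e"
      using factor[OF \<nu>(1)] by metis
    have mor: "\<mu> \<in> Mor \<Lambda>" "e \<in> Mor \<Lambda>" "\<nu> \<in> Mor \<Lambda>" using e \<nu> of_degreeD by auto
    have src_e: "src \<Lambda> (M (insert i A)) = src \<Lambda> e" using mor e src_cmp by metis
    then have "e \<star> \<nu> \<in> of_degree \<Lambda> (eps i + sum eps (I - insert i A))"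
      using cmp_of_degree[OF e(2) \<nu>(2)] \<nu>(3) by simp
    moreover have "eps i + sum eps (I - insert i A) = sum eps (I - A)"
      using A I by (metis Diff_insert finite_Diff sum.remove)
    moreover have "src \<Lambda> \<mu> = rng \<Lambda> (e \<star> \<nu>)" using e \<nu> mor src_e rng_cmp by metis
    moreover have "\<kappa> = \<mu> \<star> (e \<star> \<nu>)" using e \<nu> mor src_e cmp_assoc by metis
    \<comment> \<open>Both \<open>\<mu>\<close> and \<open>M A\<close> are the initial segment of \<open>\<kappa>\<close> of degree \<open>sum eps A\<close>.\<close>
    ultimately have "M A = \<mu>"
      using M[OF A(1)] e(1) factor_unique unfolding prefix_def by metis
    then show ?thesis using e src_e by metis
  qed
  then obtain E where E: "\<And>A i. A \<subseteq> I \<Longrightarrow> i \<in> I - A \<Longrightarrow>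
      E A i \<in> edges \<Lambda> i \<and> src \<Lambda> (E A i) = src \<Lambda> (M (insert i A)) \<and> rng \<Lambda> (E A i) = src \<Lambda> (M A)"
    by metis
  have "inj_on (\<lambda>A. src \<Lambda> (M A)) (Pow I)"
  proof (rule inj_onI)
    fix A B assume AB: "A \<in> Pow I" "B \<in> Pow I" "src \<Lambda> (M A) = src \<Lambda> (M B)"
    then have "M A = M B" using parallel_eq[OF sc] deg_M rng_M by auto
    then have "sum eps A = sum eps B" using deg_M AB by (metis PowD)
    then show "A = B" using sum_eps_inject AB I finite_subset by (metis PowD)
  qed
  then show ?thesis using that[of "\<lambda>A. src \<Lambda> (M A)" E] E deg_M src_vertex by auto
qed

lemma exists_edge:
  assumes "connected_kgraph \<Lambda>" "card (vertices \<Lambda>) > 1"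
  obtains i e where "i \<in> {1..k}" "e \<in> edges \<Lambda> i"
proof -
  obtain u v where uv: "u \<in> vertices \<Lambda>" "v \<in> vertices \<Lambda>" "u \<noteq> v"
    using assms(2) by (metis One_nat_def card.infinite card_le_Suc0_iff_eq not_less zero_le)
  let ?R = "\<lambda>x y. x \<in> vertices \<Lambda> \<and> y \<in> vertices \<Lambda> \<and> hom_set \<Lambda> x y \<noteq> {}"
  have "\<exists>x y. ?R x y \<and> x \<noteq> y"
  proof (rule ccontr)
    assume *: "\<nexists>x y. ?R x y \<and> x \<noteq> y"
    have "equivclp ?R u v" using assms(1) uv unfolding connected_kgraph_def by blast
    then have "u = v"
    proof (induction rule: equivclp_induct)
      case (step y z) then show ?case using * by blast
    qed simp
    then show False using uv by blast
  qed
  then obtain \<kappa> where \<kappa>: "\<kappa> \<in> Mor \<Lambda>" "rng \<Lambda> \<kappa> \<noteq> src \<Lambda> \<kappa>" by (auto simp: hom_set_def)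
  have "deg \<Lambda> \<kappa> \<noteq> 0"
  proof
    assume "deg \<Lambda> \<kappa> = 0"
    then have "\<kappa> \<in> objects \<Lambda>" using \<kappa>(1) vertices_eq_objects by (auto simp: of_degree_def)
    then show False using \<kappa>(2) by (simp add: objects_def)
  qed
  then obtain i where i: "i \<in> Poly_Mapping.keys (deg \<Lambda> \<kappa>)" by (metis all_not_in_conv keys_eq_empty)
  have "deg \<Lambda> \<kappa> = eps i + (deg \<Lambda> \<kappa> - eps i)"
  proof (rule poly_mapping_eqI)
    fix j show "Poly_Mapping.lookup (deg \<Lambda> \<kappa>) j = Poly_Mapping.lookup (eps i + (deg \<Lambda> \<kappa> - eps i)) j"
      using i by (auto simp: lookup_add lookup_minus eps_def lookup_single when_def in_keys_iff)
  qed
  then have "\<kappa> \<in> of_degree \<Lambda> (eps i + (deg \<Lambda> \<kappa> - eps i))" using \<kappa>(1) by (simp add: of_degree_def)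
  then obtain e where "e \<in> edges \<Lambda> i" by (rule factor)
  moreover have "i \<in> {1..k}" using i deg_in[OF \<kappa>(1)] by (auto simp: Nk_def)
  ultimately show ?thesis using that by blast
qed

lemma exists_terminal_receiver:
  assumes "finite_kgraph \<Lambda>" "singly_connected \<Lambda>" "i \<in> {1..k}" "e \<in> edges \<Lambda> i"
  obtains j f where "j \<in> {1..k}" "f \<in> edges \<Lambda> j"
    "\<And>l g. l \<in> {1..k} \<Longrightarrow> g \<in> edges \<Lambda> l \<Longrightarrow> src \<Lambda> g \<noteq> rng \<Lambda> f"
proof -
  define R where "R = {(rng \<Lambda> \<kappa>, src \<Lambda> \<kappa>) |\<kappa>. \<kappa> \<in> Mor \<Lambda> \<and> deg \<Lambda> \<kappa> \<noteq> 0}"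
  have "R \<subseteq> vertices \<Lambda> \<times> vertices \<Lambda>" using rng_vertex src_vertex by (auto simp: R_def)
  then have "finite R" using assms(1) finite_subset by (auto simp: finite_kgraph_def)
  have "trans R"
  proof (rule transI)
    fix x y z assume "(x, y) \<in> R" "(y, z) \<in> R"
    then obtain \<mu> \<nu> where \<mu>\<nu>: "\<mu> \<in> Mor \<Lambda>" "deg \<Lambda> \<mu> \<noteq> 0" "x = rng \<Lambda> \<mu>" "y = src \<Lambda> \<mu>"
      "\<nu> \<in> Mor \<Lambda>" "y = rng \<Lambda> \<nu>" "z = src \<Lambda> \<nu>" by (auto simp: R_def)
    have "deg \<Lambda> \<mu> + deg \<Lambda> \<nu> \<noteq> 0"
      using \<mu>\<nu>(2) by (auto simp: poly_mapping_eq_iff fun_eq_iff lookup_add)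
    then have "\<mu> \<star> \<nu> \<in> Mor \<Lambda>" "deg \<Lambda> (\<mu> \<star> \<nu>) \<noteq> 0" "rng \<Lambda> (\<mu> \<star> \<nu>) = x" "src \<Lambda> (\<mu> \<star> \<nu>) = z"
      using \<mu>\<nu> deg_cmp rng_cmp src_cmp cmp_in by auto
    then show "(x, z) \<in> R" unfolding R_def by blast
  qed
  moreover have "irrefl R"
  proof (rule irreflI, rule notI)
    fix x assume "(x, x) \<in> R"
    then obtain \<kappa> where \<kappa>: "\<kappa> \<in> Mor \<Lambda>" "deg \<Lambda> \<kappa> \<noteq> 0" "x = rng \<Lambda> \<kappa>" "x = src \<Lambda> \<kappa>"
      by (auto simp: R_def)
    have "\<kappa> = rng \<Lambda> \<kappa>"
      using parallel_eq[OF assms(2) \<kappa>(1) rng_in[OF \<kappa>(1)]] \<kappa> rng_rng src_rng by simp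
    then show False using \<kappa> rng_object deg_object by metis
  qed
  ultimately have "acyclic R" by (simp add: acyclic_irrefl)
  with \<open>finite R\<close> have wf: "wf R" by (rule finite_acyclic_wf)
  let ?X = "{rng \<Lambda> f |f j. j \<in> {1..k} \<and> f \<in> edges \<Lambda> j}"
  have "rng \<Lambda> e \<in> ?X" using assms by blast
  then obtain v where v: "v \<in> ?X" "\<And>u. (u, v) \<in> R \<Longrightarrow> u \<notin> ?X"
    by (rule wfE_min[OF wf]) blast
  then obtain f j where f: "j \<in> {1..k}" "f \<in> edges \<Lambda> j" "v = rng \<Lambda> f" by blast
  have "src \<Lambda> g \<noteq> v" if g: "l \<in> {1..k}" "g \<in> edges \<Lambda> l" for l g
  proof
    assume "src \<Lambda> g = v"
    moreover have "deg \<Lambda> g \<noteq> 0"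
      using g by (auto simp: of_degree_def eps_def poly_mapping_eq_iff fun_eq_iff lookup_single when_def)
    ultimately have "(rng \<Lambda> g, v) \<in> R" using g of_degreeD unfolding R_def by blast
    moreover have "rng \<Lambda> g \<in> ?X" using g by blast
    ultimately show False using v(2) by blast
  qed
  then show ?thesis using that f by blast
qed

text \<open>
  In a square \<open>\<mu> \<star> \<nu> = \<nu>' \<star> \<mu>'\<close> the ranges of \<open>\<nu>\<close> and \<open>\<mu>'\<close> are the sources of \<open>\<mu>\<close> and \<open>\<nu>'\<close>, so an edge
  with terminal range is \<open>\<mu>\<close> or \<open>\<nu>'\<close>, and these two share their range.
\<close>

lemma terminal_receives_all_colours:
  assumes "edge_nondegenerate k \<Lambda>" and i: "i \<in> {1..k}" and e: "e \<in> edges \<Lambda> i"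
    and terminal: "\<And>l g. l \<in> {1..k} \<Longrightarrow> g \<in> edges \<Lambda> l \<Longrightarrow> src \<Lambda> g \<noteq> rng \<Lambda> e"
    and j: "j \<in> {1..k}"
  shows "\<exists>f\<in>edges \<Lambda> j. rng \<Lambda> f = rng \<Lambda> e"
proof (cases "j = i")
  case False
  then obtain \<kappa> \<mu> \<nu> \<nu>' \<mu>' where sq: "commuting_square \<Lambda> i j \<kappa> \<mu> \<nu> \<nu>' \<mu>'"
    and mem: "e \<in> {\<mu>, \<nu>, \<nu>', \<mu>'}"
    using assms by (metis edge_nondegenerate_def)
  have \<mu>: "\<mu> \<in> edges \<Lambda> i" "\<nu> \<in> edges \<Lambda> j" "src \<Lambda> \<mu> = rng \<Lambda> \<nu>" "\<nu>' \<in> edges \<Lambda> j" "\<mu>' \<in> edges \<Lambda> i"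
    "src \<Lambda> \<nu>' = rng \<Lambda> \<mu>'" "\<mu> \<star> \<nu> = \<nu>' \<star> \<mu>'"
    using sq by (auto simp: commuting_square_def)
  have "rng \<Lambda> \<mu> = rng \<Lambda> \<nu>'" using \<mu> rng_cmp of_degreeD by metis
  moreover have "e \<noteq> \<nu>" "e \<noteq> \<mu>'" using terminal \<mu> i j by metis+
  ultimately show ?thesis using mem \<mu> by auto
qed (use e in blast)

lemma skeleton_ends:
  "\<forall>e\<in>arcs (skeleton k \<Lambda>). tail (skeleton k \<Lambda>) e \<in> verts (skeleton k \<Lambda>) \<and>
    head (skeleton k \<Lambda>) e \<in> verts (skeleton k \<Lambda>)"
  by (auto simp: skeleton_def dest!: of_degreeD intro: rng_vertex src_vertex)

lemma skeleton_not_planar: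
  assumes "finite_kgraph \<Lambda>" "connected_kgraph \<Lambda>" "singly_connected \<Lambda>" "locally_convex k \<Lambda>"
    and "card (vertices \<Lambda>) > 1" "edge_nondegenerate k \<Lambda>" and k: "k \<ge> 4"
  shows "\<not> planar (skeleton k \<Lambda>)"
proof -
  obtain i e where "i \<in> {1..k}" "e \<in> edges \<Lambda> i"
    using exists_edge assms by metis
  then obtain j f where f: "j \<in> {1..k}" "f \<in> edges \<Lambda> j"
    "\<And>l g. l \<in> {1..k} \<Longrightarrow> g \<in> edges \<Lambda> l \<Longrightarrow> src \<Lambda> g \<noteq> rng \<Lambda> f"
    using exists_terminal_receiver assms by metis
  have "\<forall>i\<in>{1..4}. \<exists>e\<in>edges \<Lambda> i. rng \<Lambda> e = rng \<Lambda> f"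
    using terminal_receives_all_colours[OF assms(6) f] k by auto
  moreover have "rng \<Lambda> f \<in> vertices \<Lambda>" using f of_degreeD rng_vertex by blast
  ultimately obtain \<kappa> where \<kappa>: "\<kappa> \<in> of_degree \<Lambda> (sum eps {1..4})"
    using cube_morphism[OF assms(4), of "{1..4}" "rng \<Lambda> f"] k by auto
  obtain P E where cube: "inj_on P (Pow {1..4})" "\<And>A. A \<subseteq> {1..4} \<Longrightarrow> P A \<in> vertices \<Lambda>"
    "\<And>A i. A \<subseteq> {1..4} \<Longrightarrow> i \<in> {1..4} - A \<Longrightarrow>
      E A i \<in> edges \<Lambda> i \<and> src \<Lambda> (E A i) = P (insert i A) \<and> rng \<Lambda> (E A i) = P A"
    using cube_in_skeleton[OF assms(3) _ \<kappa>] by auto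
  show ?thesis
  proof (rule not_planar_four_cube[OF skeleton_ends cube(1)])
    show "P A \<in> verts (skeleton k \<Lambda>)" if "A \<subseteq> {1..4}" for A
      using cube(2)[OF that] by (simp add: skeleton_def)
    show "E A i \<in> arcs (skeleton k \<Lambda>) \<and> tail (skeleton k \<Lambda>) (E A i) = P (insert i A) \<and>
        head (skeleton k \<Lambda>) (E A i) = P A" if "A \<subseteq> {1..4}" "i \<in> {1..4} - A" for A i
    proof -
      have "i \<in> {1..k}" using that(2) k by auto
      then show ?thesis using cube(3)[OF that] by (auto simp: skeleton_def)
    qed
  qed
qed

end

theorem theorem1p1:
  fixes \<Lambda> :: "'a kgraph" and k :: nat
  assumes "higher_rank_tree k \<Lambda>"
    and "finite_kgraph \<Lambda>"
    and "connected_kgraph \<Lambda>"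
    and "singly_connected \<Lambda>"
    and "locally_convex k \<Lambda>"
    and "card (vertices \<Lambda>) > 1"
    and "edge_nondegenerate k \<Lambda>"
  shows "(k \<ge> 5 \<longrightarrow> \<not> planar (skeleton k \<Lambda>)) \<and> (planar (skeleton k \<Lambda>) \<longrightarrow> k \<le> 4)"
proof -
  have "k_graph k \<Lambda>" using assms(1) by (simp add: higher_rank_tree_def)
  then have "k \<ge> 4 \<longrightarrow> \<not> planar (skeleton k \<Lambda>)"
    using k_graph.skeleton_not_planar assms(2-7) by blast
  then show ?thesis by arith
qed

end
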